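(* Let $k$ be a positive integer, let $n=3k$, and let $A_1,A_2,\ldots,A_n$ be positive definite matrices of the same size $p\times p$. Then $$\frac{1}{n^3}\Big\|\sum_{j_1,j_2,j_3=1}^{n}A_{j_1}A_{j_2}A_{j_3}\Big\|\;\geq\;\frac{(n-3)!}{n!}\Big\|\sum_{\substack{j_1,j_2,j_3=1,\\ j_1,\,j_2,\,j_3\text{ all distinct}}}^{n}A_{j_1}A_{j_2}A_{j_3}\Big\|.$$
   Context: $\|\cdot\|$ denotes the operator norm, i.e. the largest singular value. Positive definite matrices are understood to be real symmetric, with $p\geq 1$ arbitrary. The first sum runs over all triples $(j_1,j_2,j_3)\in\{1,\ldots,n\}^3$; the second runs over all ordered triples with pairwise distinct entries. *)

theory Defs
  imports "HOL-Analysis.Analysis"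
begin

definition positive_definite :: "real ^ 'p ^ 'p \<Rightarrow> bool" where
  "positive_definite A \<longleftrightarrow> transpose A = A \<and> (\<forall>x. x \<noteq> 0 \<longrightarrow> x \<bullet> (A *v x) > 0)"

end

theory Submission
  imports Defs "HOL-Combinatorics.Permutations"
begin

text \<open>
  The theorem rests on the case of three matrices. Let \<open>A, B, C\<close> be positive semidefinite
  with \<open>S = A + B + C \<le> 3d\<close>, and let \<open>D\<close> be the sum of the six products of \<open>A, B, C\<close> in all
  orders. Then \<open>-6d^3 \<le> D \<le> 6d^3\<close>, and both bounds come from sums of squares.

  The upper bound (\<open>symprod_upper\<close>) pairs each product with its reversal:
  \<open>2(ABC + CBA) = PBP - (A-C)B(A-C) \<le> PBP\<close> with \<open>P = A + C\<close>, and \<open>B \<le> 3d - P\<close>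
  gives \<open>PBP \<le> P^2(3d - P) \<le> 4d^3\<close>.

  The lower bound (\<open>symprod_lower\<close>) starts from the identity
  \<open>-D = \<Sum> A(S-A)A - \<Sum> (S-A)A(S-A)\<close>, the sums running over the three matrices. Since
  \<open>S \<le> 3d\<close>, the first sum is at most \<open>\<Sum> (3dA^2 - A^3)\<close>. Discarding the second sum would
  leave only \<open>(27/4) d^3\<close>, whose extremal case \<open>A = B = 3d/2, C = 0\<close> is not one where the
  second sum is small. The proof therefore keeps half of the second sum and compares \<open>S\<close> in it
  with the scalar \<open>3d\<close>; the cost of that comparison is controlled by the defect \<open>3d - S\<close>. What
  remains are polynomial inequalities in a single positive operator.

  For \<open>n = 3k\<close> matrices, split the indices into three blocks of size \<open>k\<close> and apply the case
  of three to the block sums. Their total is the sum of all the matrices, whatever the splitting,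
  so the same \<open>d\<close> serves for every permutation of the indices. Averaging over all permutations
  turns the six products of block sums into a multiple of the sum over distinct triples, as each
  distinct triple is hit equally often (\<open>sum_permutations_triple\<close>); the constant obtained
  is exactly the required one because the blocks are balanced.

  Finally, the sum over all triples is \<open>S^3\<close>. A bound on the norm of \<open>S^3\<close> is one on \<open>S\<close>
  (\<open>psd_le_cube_norm\<close>), and the sum over distinct triples is symmetric, so that its norm is
  controlled by its quadratic form (\<open>onorm_symmetric_le\<close>).
\<close>

section \<open>Positive semidefinite operators\<close>

text \<open>Operators instead of matrices, so that block sums are plain functions and no dimension
  enters the inequalities.\<close>
definition psd :: "('a::real_inner \<Rightarrow> 'a) \<Rightarrow> bool" where
  "psd A \<longleftrightarrow> linear A \<and> (\<forall>x y. A x \<bullet> y = x \<bullet> A y) \<and> (\<forall>x. 0 \<le> x \<bullet> A x)"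

lemma psd_nonneg: "psd A \<Longrightarrow> 0 \<le> x \<bullet> A x"
  and psd_sym: "psd A \<Longrightarrow> A x \<bullet> y = x \<bullet> A y"
  and psd_linear: "psd A \<Longrightarrow> linear A"
  by (auto simp: psd_def)

lemma psd_add: "psd A \<Longrightarrow> psd B \<Longrightarrow> psd (\<lambda>x. A x + B x)"
  unfolding psd_def by (auto intro!: linear_compose_add simp: inner_simps)

lemma psd_sum:
  assumes "\<And>j. j \<in> J \<Longrightarrow> psd (A j)"
  shows "psd (\<lambda>x. \<Sum>j\<in>J. A j x)"
  using assms unfolding psd_def
  by (auto intro!: linear_compose_sum sum_nonneg simp: inner_sum_left inner_sum_right)

lemmas psd_expand = linear_add linear_diff linear_scale inner_simps

section \<open>Polynomial inequalities in one operator\<close>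

text \<open>The scalar inequality \<open>x^2(3d - x) \<le> 4d^3\<close> for \<open>x \<ge> 0\<close>, applied to \<open>P\<close>: the
  difference is \<open>(x - 2d)^2(x + d)\<close>, which is a positive form in the vector \<open>w\<close>.\<close>
lemma psd_square_cubic_bound:
  assumes P: "psd P" and d: "0 \<le> d"
  shows "3 * d * (P v \<bullet> P v) - P v \<bullet> P (P v) \<le> 4 * d ^ 3 * (v \<bullet> v)"
proof -
  define w where "w = P v - (2 * d) *\<^sub>R v"
  have s: "P (P v) \<bullet> P v = P v \<bullet> P (P v)" "v \<bullet> P (P v) = P v \<bullet> P v" "v \<bullet> P v = P v \<bullet> v"
    using P by (auto simp: psd_sym)
  have "0 \<le> w \<bullet> P w + d * (w \<bullet> w)"
    using psd_nonneg[OF P] d by simp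
  also have "\<dots> = 4 * d ^ 3 * (v \<bullet> v) - (3 * d * (P v \<bullet> P v) - P v \<bullet> P (P v))"
    unfolding w_def
    by (simp add: psd_expand psd_linear[OF P] s algebra_simps power2_eq_square power3_eq_cube)
  finally show ?thesis by simp
qed

text \<open>The scalar form is \<open>3dx^2 - x^3 - x(3d - x)^2/4 \<le> 2d^2 x\<close> for \<open>x \<ge> 0\<close>; after division
  by \<open>x\<close> the left side is largest at \<open>x = 9d/5\<close>, where it equals \<open>(9/5)d^2\<close>. The bound is linear
  in the operator so that it can be added over several operators of which only the sum is
  controlled. The weight \<open>1/4\<close> comes from retaining half of the negative sum and losing another
  factor of two in replacing \<open>S\<close> by \<open>3d\<close>.\<close>
lemma psd_cubic_linear_bound:
  assumes B: "psd B"
  shows "3 * d * (B v \<bullet> B v) - B v \<bullet> B (B v)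
           - ((3 * d) *\<^sub>R v - B v) \<bullet> B ((3 * d) *\<^sub>R v - B v) / 4 \<le> 2 * d\<^sup>2 * (v \<bullet> B v)"
proof -
  define w where "w = B v - (9 * d / 5) *\<^sub>R v"
  have s: "B (B v) \<bullet> B v = B v \<bullet> B (B v)" "v \<bullet> B (B v) = B v \<bullet> B v" "v \<bullet> B v = B v \<bullet> v"
    using B by (auto simp: psd_sym)
  have "0 \<le> 5 / 4 * (w \<bullet> B w) + d\<^sup>2 / 5 * (v \<bullet> B v)"
    using psd_nonneg[OF B] by simp
  also have "\<dots> = 2 * d\<^sup>2 * (v \<bullet> B v) - (3 * d * (B v \<bullet> B v) - B v \<bullet> B (B v)
           - ((3 * d) *\<^sub>R v - B v) \<bullet> B ((3 * d) *\<^sub>R v - B v) / 4)"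
    unfolding w_def
    by (simp add: psd_expand psd_linear[OF B] s field_simps power2_eq_square)
  finally show ?thesis by simp
qed

text \<open>With \<open>y = 3d - x \<ge> 0\<close> for the defect, this is \<open>y^2(3d - y) \<le> (9/4)d^2 y\<close>, the
  difference being \<open>y(y - 3d/2)^2\<close>. Linearity in the defect matters: the error vanishes where
  \<open>S\<close> attains its bound, which is where the other terms are largest.\<close>
lemma psd_defect_bound:
  assumes S: "psd S" and le: "\<And>x. x \<bullet> S x \<le> 3 * d * (x \<bullet> x)"
  defines "r \<equiv> \<lambda>v. (3 * d) *\<^sub>R v - S v"
  shows "r v \<bullet> S (r v) \<le> 9 / 4 * d\<^sup>2 * (v \<bullet> r v)"
proof -
  define w where "w = r v - (3 * d / 2) *\<^sub>R v"
  have s: "S (S v) \<bullet> S v = S v \<bullet> S (S v)" "v \<bullet> S (S v) = S v \<bullet> S v" "v \<bullet> S v = S v \<bullet> v"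
    using S by (auto simp: psd_sym)
  have "0 \<le> 3 * d * (w \<bullet> w) - w \<bullet> S w"
    using le[of w] by simp
  also have "\<dots> = 9 / 4 * d\<^sup>2 * (v \<bullet> r v) - r v \<bullet> S (r v)"
    unfolding w_def r_def
    by (simp add: psd_expand psd_linear[OF S] s field_simps power2_eq_square)
  finally show ?thesis by simp
qed

section \<open>The case of three operators\<close>

text \<open>For self-adjoint operators this is the quadratic form at \<open>v\<close> of the sum of the six products:
  the leftmost factor has been moved to the other side of the inner product.\<close>
definition symprod :: "('a::real_inner \<Rightarrow> 'a) \<Rightarrow> ('a \<Rightarrow> 'a) \<Rightarrow> ('a \<Rightarrow> 'a) \<Rightarrow> 'a \<Rightarrow> real" where
  "symprod A B C v = A v \<bullet> B (C v) + C v \<bullet> B (A v) + B v \<bullet> A (C v) + C v \<bullet> A (B v)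
                   + A v \<bullet> C (B v) + B v \<bullet> C (A v)"

lemma symprod_upper:
  assumes psd: "psd A" "psd B" "psd C" and d: "0 \<le> d"
    and le: "\<And>x. x \<bullet> A x + x \<bullet> B x + x \<bullet> C x \<le> 3 * d * (x \<bullet> x)"
  shows "symprod A B C v \<le> 6 * d ^ 3 * (v \<bullet> v)"
proof -
  have *: "X v \<bullet> Y (Z v) + Z v \<bullet> Y (X v) \<le> 2 * d ^ 3 * (v \<bullet> v)"
    if "psd X" "psd Y" "psd Z" and
      l: "\<And>x. x \<bullet> X x + x \<bullet> Y x + x \<bullet> Z x \<le> 3 * d * (x \<bullet> x)" for X Y Z :: "'a \<Rightarrow> 'a"
  proof -
    define p where "p = X v + Z v"
    have "2 * (X v \<bullet> Y (Z v) + Z v \<bullet> Y (X v))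
        = p \<bullet> Y p - (X v - Z v) \<bullet> Y (X v - Z v)"
      unfolding p_def by (simp add: psd_expand psd_linear[OF \<open>psd Y\<close>])
    also have "\<dots> \<le> p \<bullet> Y p"
      using psd_nonneg[OF \<open>psd Y\<close>] by simp
    also have "\<dots> \<le> 3 * d * (p \<bullet> p) - p \<bullet> (X p + Z p)"
      using l[of p] by (simp add: inner_simps)
    also have "\<dots> \<le> 4 * d ^ 3 * (v \<bullet> v)"
      using psd_square_cubic_bound[OF psd_add[OF \<open>psd X\<close> \<open>psd Z\<close>] d, of v] unfolding p_def .
    finally show ?thesis by simp
  qed
  have "x \<bullet> B x + x \<bullet> A x + x \<bullet> C x \<le> 3 * d * (x \<bullet> x)"
       "x \<bullet> A x + x \<bullet> C x + x \<bullet> B x \<le> 3 * d * (x \<bullet> x)" for x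
    using le[of x] by simp_all
  then show ?thesis
    using *[OF psd le] *[of B A C] *[of A C B] psd unfolding symprod_def by force
qed

text \<open>In the proof, \<open>E X\<close> is one term of the negative sum of squares and \<open>F X\<close> its version with \<open>S\<close> replaced by the scalar \<open>3d\<close>. The final estimate is
  \<open>2d^2 S + (9/8)d^2(3d - S)\<close>, which is at most \<open>6d^3\<close> on the whole range of \<open>S\<close>.\<close>
lemma symprod_lower:
  assumes psd: "psd A" "psd B" "psd C" and d: "0 \<le> d"
    and le: "\<And>x. x \<bullet> A x + x \<bullet> B x + x \<bullet> C x \<le> 3 * d * (x \<bullet> x)"
  shows "- symprod A B C v \<le> 6 * d ^ 3 * (v \<bullet> v)"
proof -
  define S where "S = (\<lambda>x. A x + B x + C x)"
  have S: "psd S" unfolding S_def by (intro psd_add psd)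
  have S_le: "x \<bullet> S x \<le> 3 * d * (x \<bullet> x)" for x
    using le[of x] by (simp add: S_def inner_simps)
  define r where "r = (3 * d) *\<^sub>R v - S v"
  define E where "E = (\<lambda>X::'a \<Rightarrow> 'a. (S v - X v) \<bullet> X (S v - X v))"
  define F where "F = (\<lambda>X::'a \<Rightarrow> 'a. ((3 * d) *\<^sub>R v - X v) \<bullet> X ((3 * d) *\<^sub>R v - X v))"
  have id: "- symprod A B C v
      = A v \<bullet> (B (A v) + C (A v)) + B v \<bullet> (A (B v) + C (B v)) + C v \<bullet> (A (C v) + B (C v))
        - (E A + E B + E C)"
    unfolding symprod_def E_def S_def
    by (simp add: psd_expand psd_linear psd)
  have EF: "F X / 2 - r \<bullet> X r \<le> E X" if X: "psd X" for X
  proof -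
    define x where "x = (3 * d) *\<^sub>R v - X v"
    have e: "S v - X v = x - r" by (simp add: x_def r_def)
    \<comment> \<open>In the seminorm of \<open>X\<close>: \<open>|x - r|^2 - |x|^2/2 + |r|^2 = |x - 2r|^2/2\<close>.\<close>
    have "0 \<le> (x - 2 *\<^sub>R r) \<bullet> X (x - 2 *\<^sub>R r) / 2"
      using psd_nonneg[OF X] by simp
    also have "\<dots> = E X - (F X / 2 - r \<bullet> X r)"
      using psd_sym[OF X, of x r]
      unfolding E_def F_def e x_def[symmetric]
      by (simp add: psd_expand psd_linear[OF X] inner_commute field_simps)
    finally show ?thesis by simp
  qed
  have E0: "0 \<le> E X" if "psd X" for X
    unfolding E_def by (rule psd_nonneg[OF that])
  have rSr: "r \<bullet> A r + r \<bullet> B r + r \<bullet> C r \<le> 9 / 4 * d\<^sup>2 * (v \<bullet> r)"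
    using psd_defect_bound[OF S S_le, of v] unfolding r_def by (simp add: S_def inner_simps)
  have vr: "0 \<le> v \<bullet> r"
    using S_le[of v] by (simp add: r_def inner_simps)
  have poly: "3 * d * (X v \<bullet> X v) - X v \<bullet> X (X v) - F X / 4 \<le> 2 * d\<^sup>2 * (v \<bullet> X v)"
    if "psd X" for X
    using psd_cubic_linear_bound[OF that] unfolding F_def .
  have vS: "v \<bullet> A v + v \<bullet> B v + v \<bullet> C v = 3 * d * (v \<bullet> v) - v \<bullet> r"
    by (simp add: r_def S_def inner_simps)
  have "- symprod A B C v
      \<le> (3 * d * (A v \<bullet> A v) - A v \<bullet> A (A v)) + (3 * d * (B v \<bullet> B v) - B v \<bullet> B (B v))
        + (3 * d * (C v \<bullet> C v) - C v \<bullet> C (C v)) - (E A + E B + E C)"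
    unfolding id using le[of "A v"] le[of "B v"] le[of "C v"] by (simp add: inner_simps)
  also have "\<dots> \<le> 2 * d\<^sup>2 * (v \<bullet> A v) + 2 * d\<^sup>2 * (v \<bullet> B v) + 2 * d\<^sup>2 * (v \<bullet> C v)
        + (r \<bullet> A r + r \<bullet> B r + r \<bullet> C r) / 2"
    using poly[OF psd(1)] poly[OF psd(2)] poly[OF psd(3)]
      EF[OF psd(1)] EF[OF psd(2)] EF[OF psd(3)]
      E0[OF psd(1)] E0[OF psd(2)] E0[OF psd(3)] by argo
  also have "\<dots> \<le> 2 * d\<^sup>2 * (v \<bullet> A v + v \<bullet> B v + v \<bullet> C v) + 9 / 8 * d\<^sup>2 * (v \<bullet> r)"
    using rSr by (simp add: algebra_simps)
  also have "\<dots> = 6 * d ^ 3 * (v \<bullet> v) - 7 / 8 * d\<^sup>2 * (v \<bullet> r)"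
    unfolding vS by (simp add: algebra_simps power2_eq_square power3_eq_cube)
  also have "\<dots> \<le> 6 * d ^ 3 * (v \<bullet> v)"
    using vr by simp
  finally show ?thesis .
qed

section \<open>Averaging over permutations\<close>

definition distinct_triples :: "'i set \<Rightarrow> ('i \<times> 'i \<times> 'i) set" where
  "distinct_triples I = {(a, b, c). a \<in> I \<and> b \<in> I \<and> c \<in> I \<and> a \<noteq> b \<and> a \<noteq> c \<and> b \<noteq> c}"

lemma permutes_triple_exists:
  assumes "(i, j, l) \<in> distinct_triples I" "(a, b, c) \<in> distinct_triples I"
  obtains p where "p permutes I" "p i = a" "p j = b" "p l = c"
proof -
  define p1 where "p1 = Transposition.transpose i a"
  define p2 where "p2 = Transposition.transpose (p1 j) b \<circ> p1"
  define p3 where "p3 = Transposition.transpose (p2 l) c \<circ> p2"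
  have p1: "p1 permutes I" "p1 i = a"
    using assms by (auto simp: p1_def distinct_triples_def intro: permutes_swap_id)
  then have j: "p1 j \<in> I" "p1 j \<noteq> a"
    using assms by (auto simp: distinct_triples_def permutes_in_image dest: permutes_inj injD)
  have p2: "p2 permutes I" "p2 i = a" "p2 j = b"
    using assms p1 j
    by (auto simp: p2_def distinct_triples_def Transposition.transpose_def intro: permutes_compose permutes_swap_id)
  then have l: "p2 l \<in> I" "p2 l \<noteq> a" "p2 l \<noteq> b"
    using assms by (auto simp: distinct_triples_def permutes_in_image dest: permutes_inj injD)
  have "p3 permutes I" "p3 i = a" "p3 j = b" "p3 l = c"
    using assms p2 l
    by (auto simp: p3_def distinct_triples_def Transposition.transpose_def intro: permutes_compose permutes_swap_id)
  then show thesis by (rule that)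
qed

text \<open>Composition with one such permutation identifies this set with the stabiliser of the three
  points, that is, with the permutations of the other points.\<close>
lemma card_permutes_triple:
  assumes I: "finite I"
    and t: "(i, j, l) \<in> distinct_triples I" "(a, b, c) \<in> distinct_triples I"
  shows "card {p. p permutes I \<and> p i = a \<and> p j = b \<and> p l = c} = fact (card I - 3)"
proof -
  obtain q where q: "q permutes I" "q i = a" "q j = b" "q l = c"
    using permutes_triple_exists[OF t] .
  have inv: "inv q permutes I" "inv q a = i" "inv q b = j" "inv q c = l"
    using q permutes_inv[of q I] permutes_inverses(2)[of q I] by auto
  let ?J = "I - {i, j, l}"
  have "bij_betw (\<lambda>p. q \<circ> p) {p. p permutes ?J} {p. p permutes I \<and> p i = a \<and> p j = b \<and> p l = c}"
  proof (rule bij_betw_byWitness[where f' = "\<lambda>p. inv q \<circ> p"])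
    show "\<forall>p\<in>{p. p permutes ?J}. inv q \<circ> (q \<circ> p) = p"
      using permutes_inv_o(2)[OF q(1)] by (simp add: o_assoc)
    show "\<forall>p\<in>{p. p permutes I \<and> p i = a \<and> p j = b \<and> p l = c}. q \<circ> (inv q \<circ> p) = p"
      using permutes_inv_o(1)[OF q(1)] by (simp add: o_assoc)
    show "(\<lambda>p. q \<circ> p) ` {p. p permutes ?J} \<subseteq> {p. p permutes I \<and> p i = a \<and> p j = b \<and> p l = c}"
    proof safe
      fix p assume p: "p permutes ?J"
      then have "p permutes I" by (rule permutes_subset) auto
      then show "(q \<circ> p) permutes I" using q(1) by (rule permutes_compose)
      show "(q \<circ> p) i = a" "(q \<circ> p) j = b" "(q \<circ> p) l = c"
        using q p by (auto simp: permutes_not_in)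
    qed
    show "(\<lambda>p. inv q \<circ> p) ` {p. p permutes I \<and> p i = a \<and> p j = b \<and> p l = c} \<subseteq> {p. p permutes ?J}"
    proof safe
      fix p assume p: "p permutes I" "a = p i" "b = p j" "c = p l"
      have "(inv q \<circ> p) permutes I" using p(1) inv(1) by (rule permutes_compose)
      then show "(inv q \<circ> p) permutes ?J"
        by (rule permutes_superset) (use inv p in auto)
    qed
  qed
  then have "card {p. p permutes I \<and> p i = a \<and> p j = b \<and> p l = c} = card {p. p permutes ?J}"
    by (simp add: bij_betw_same_card)
  also have "\<dots> = fact (card ?J)"
    using I by (simp add: card_permutations)
  also have "card ?J = card I - 3"
    using t(1) by (subst card_Diff_subset) (auto simp: distinct_triples_def)
  finally show ?thesis .
qed

lemma sum_permutations_triple: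
  fixes g :: "'i \<Rightarrow> 'i \<Rightarrow> 'i \<Rightarrow> real"
  assumes I: "finite I" and t: "(i, j, l) \<in> distinct_triples I"
  shows "(\<Sum>p | p permutes I. g (p i) (p j) (p l))
       = fact (card I - 3) * (\<Sum>(a, b, c)\<in>distinct_triples I. g a b c)"
proof -
  let ?P = "{p. p permutes I}" and ?h = "\<lambda>p. (p i, p j, p l)"
  have fin: "finite (distinct_triples I)"
    by (rule finite_subset[of _ "I \<times> I \<times> I"]) (use I in \<open>auto simp: distinct_triples_def\<close>)
  have img: "?h ` ?P \<subseteq> distinct_triples I"
    using t by (auto simp: distinct_triples_def permutes_in_image dest: permutes_inj injD)
  have "(\<Sum>p\<in>?P. g (p i) (p j) (p l))
      = (\<Sum>t\<in>distinct_triples I. \<Sum>p | p \<in> ?P \<and> ?h p = t. g (p i) (p j) (p l))"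
    using sum.group[OF finite_permutations[OF I] fin img, of "\<lambda>p. g (p i) (p j) (p l)"] by simp
  also have "\<dots> = (\<Sum>(a, b, c)\<in>distinct_triples I. fact (card I - 3) * g a b c)"
  proof (rule sum.cong[OF refl], safe)
    fix a b c assume abc: "(a, b, c) \<in> distinct_triples I"
    have "(\<Sum>p | p \<in> ?P \<and> ?h p = (a, b, c). g (p i) (p j) (p l))
        = (\<Sum>p | p permutes I \<and> p i = a \<and> p j = b \<and> p l = c. g a b c)"
      by (rule sum.cong) auto
    then show "(\<Sum>p | p \<in> ?P \<and> ?h p = (a, b, c). g (p i) (p j) (p l)) = fact (card I - 3) * g a b c"
      by (simp add: card_permutes_triple[OF I t abc])
  qed
  finally show ?thesis
    by (simp add: sum_distrib_left case_prod_unfold)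
qed

text \<open>Each of the six orders of the blocks contributes, on average over the permutations, the same
  multiple of the sum over distinct triples: \<open>k^3\<close> choices of one position in each block, and
  \<open>(n - 3)!\<close> permutations for each triple of values at these positions.\<close>
lemma distinct_triples_average_bound:
  fixes A :: "'i \<Rightarrow> 'a::real_inner \<Rightarrow> 'a"
  assumes fin: "finite I" and card: "card I = 3 * k"
    and psd: "\<And>j. j \<in> I \<Longrightarrow> psd (A j)" and d: "0 \<le> d"
    and le: "\<And>x. (\<Sum>j\<in>I. x \<bullet> A j x) \<le> 3 * d * (x \<bullet> x)"
  shows "real k ^ 3 * fact (card I - 3) *
           \<bar>\<Sum>(a, b, c)\<in>distinct_triples I. A a v \<bullet> A b (A c v)\<bar>
         \<le> fact (card I) * (d ^ 3 * (v \<bullet> v))"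
proof -
  define g where "g = (\<lambda>a b c. A a v \<bullet> A b (A c v))"
  define G where "G = (\<Sum>(a, b, c)\<in>distinct_triples I. g a b c)"
  obtain X where X: "X \<subseteq> I" "card X = k"
    using obtain_subset_with_card_n[of k I] card by auto
  have "k \<le> card (I - X)"
    using X card fin by (simp add: card_Diff_subset finite_subset)
  then obtain Y where Y: "Y \<subseteq> I - X" "card Y = k"
    using obtain_subset_with_card_n[of k "I - X"] by blast
  define Z where "Z = I - X - Y"
  have Z: "card Z = k"
    using X Y card fin unfolding Z_def
    by (simp add: card_Diff_subset finite_subset[OF _ fin] finite_subset[OF _ finite_Diff[OF fin]])
  have finX: "finite X" "finite Y" "finite Z"
    using X Y fin by (auto simp: Z_def intro: finite_subset)
  have I: "I = X \<union> (Y \<union> Z)" and disj: "X \<inter> (Y \<union> Z) = {}" "Y \<inter> Z = {}"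
    using X Y by (auto simp: Z_def)
  have bound: "\<bar>symprod (\<lambda>x. \<Sum>i\<in>X. A (p i) x) (\<lambda>x. \<Sum>i\<in>Y. A (p i) x) (\<lambda>x. \<Sum>i\<in>Z. A (p i) x) v\<bar>
      \<le> 6 * d ^ 3 * (v \<bullet> v)" if p: "p permutes I" for p
  proof -
    have pI: "psd (A (p i))" if "i \<in> I" for i
      using psd that permutes_in_image[OF p] by blast
    have "x \<bullet> (\<Sum>i\<in>X. A (p i) x) + x \<bullet> (\<Sum>i\<in>Y. A (p i) x) + x \<bullet> (\<Sum>i\<in>Z. A (p i) x)
        \<le> 3 * d * (x \<bullet> x)" for x
    proof -
      have "x \<bullet> (\<Sum>i\<in>X. A (p i) x) + x \<bullet> (\<Sum>i\<in>Y. A (p i) x) + x \<bullet> (\<Sum>i\<in>Z. A (p i) x)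
          = (\<Sum>i\<in>I. x \<bullet> A (p i) x)"
        unfolding I using finX disj by (simp add: inner_sum_right sum.union_disjoint)
      also have "\<dots> = (\<Sum>i\<in>I. x \<bullet> A i x)"
        using sum.permute[OF p, of "\<lambda>i. x \<bullet> A i x"] by (simp add: o_def)
      finally show ?thesis using le[of x] by simp
    qed
    note l = this
    have ps: "psd (\<lambda>x. \<Sum>i\<in>X. A (p i) x)" "psd (\<lambda>x. \<Sum>i\<in>Y. A (p i) x)" "psd (\<lambda>x. \<Sum>i\<in>Z. A (p i) x)"
      by (intro psd_sum pI; auto simp: I)+
    show ?thesis
      using symprod_upper[OF ps d l, of v] symprod_lower[OF ps d l, of v] by linarith
  qed
  have lin: "A (p i) (\<Sum>j\<in>J. f j) = (\<Sum>j\<in>J. A (p i) (f j))"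
    if "p permutes I" "i \<in> I" for p i J and f :: "'i \<Rightarrow> 'a"
    using psd that permutes_in_image[OF that(1)] by (intro linear_sum psd_linear) blast
  have expand: "(\<Sum>i\<in>U. A (p i) v) \<bullet> (\<Sum>j\<in>V. A (p j) (\<Sum>l\<in>W. A (p l) v))
      = (\<Sum>i\<in>U. \<Sum>j\<in>V. \<Sum>l\<in>W. g (p i) (p j) (p l))"
    if p: "p permutes I" and V: "V \<subseteq> I" for p U V W
  proof -
    have "(\<Sum>j\<in>V. A (p j) (\<Sum>l\<in>W. A (p l) v)) = (\<Sum>j\<in>V. \<Sum>l\<in>W. A (p j) (A (p l) v))"
      by (rule sum.cong) (use lin[OF p] V in auto)
    then show ?thesis
      by (subst inner_sum_left) (simp add: g_def inner_sum_right)
  qed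
  have avg: "(\<Sum>p | p permutes I. (\<Sum>i\<in>U. A (p i) v) \<bullet> (\<Sum>j\<in>V. A (p j) (\<Sum>l\<in>W. A (p l) v)))
      = real k ^ 3 * fact (card I - 3) * G"
    if c: "card U = k" "card V = k" "card W = k" and s: "U \<subseteq> I" "V \<subseteq> I" "W \<subseteq> I"
      and dj: "U \<inter> V = {}" "U \<inter> W = {}" "V \<inter> W = {}" for U V W
  proof -
    have "(\<Sum>p | p permutes I. (\<Sum>i\<in>U. A (p i) v) \<bullet> (\<Sum>j\<in>V. A (p j) (\<Sum>l\<in>W. A (p l) v)))
        = (\<Sum>p | p permutes I. \<Sum>i\<in>U. \<Sum>j\<in>V. \<Sum>l\<in>W. g (p i) (p j) (p l))"
      by (rule sum.cong) (use expand s in auto)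
    also have "\<dots> = (\<Sum>i\<in>U. \<Sum>p | p permutes I. \<Sum>j\<in>V. \<Sum>l\<in>W. g (p i) (p j) (p l))"
      by (rule sum.swap)
    also have "\<dots> = (\<Sum>i\<in>U. \<Sum>j\<in>V. \<Sum>p | p permutes I. \<Sum>l\<in>W. g (p i) (p j) (p l))"
      by (subst sum.swap) simp
    also have "\<dots> = (\<Sum>i\<in>U. \<Sum>j\<in>V. \<Sum>l\<in>W. \<Sum>p | p permutes I. g (p i) (p j) (p l))"
      by (subst (3) sum.swap) simp
    also have "\<dots> = (\<Sum>i\<in>U. \<Sum>j\<in>V. \<Sum>l\<in>W. fact (card I - 3) * G)"
      unfolding G_def
      by (intro sum.cong refl sum_permutations_triple fin) (use s dj in \<open>auto simp: distinct_triples_def\<close>)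
    also have "\<dots> = real k ^ 3 * fact (card I - 3) * G"
      by (simp add: c power3_eq_cube)
    finally show ?thesis .
  qed
  have "6 * (real k ^ 3 * fact (card I - 3) * G)
     = (\<Sum>p | p permutes I. symprod (\<lambda>x. \<Sum>i\<in>X. A (p i) x) (\<lambda>x. \<Sum>i\<in>Y. A (p i) x) (\<lambda>x. \<Sum>i\<in>Z. A (p i) x) v)"
    unfolding symprod_def sum.distrib
    by (subst avg, (use X Y Z I disj in auto)[9])+ simp
  then have "6 * \<bar>real k ^ 3 * fact (card I - 3) * G\<bar>
     = \<bar>\<Sum>p | p permutes I. symprod (\<lambda>x. \<Sum>i\<in>X. A (p i) x) (\<lambda>x. \<Sum>i\<in>Y. A (p i) x) (\<lambda>x. \<Sum>i\<in>Z. A (p i) x) v\<bar>"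
    by (metis abs_mult abs_numeral)
  also have "\<dots> \<le> (\<Sum>p | p permutes I. 6 * d ^ 3 * (v \<bullet> v))"
    by (rule order_trans[OF sum_abs sum_mono]) (use bound in auto)
  also have "\<dots> = 6 * (fact (card I) * (d ^ 3 * (v \<bullet> v)))"
    by (simp add: card_permutations[OF refl fin])
  finally show ?thesis
    by (simp add: abs_mult G_def g_def)
qed

section \<open>From quadratic forms to operator norms\<close>

text \<open>Polarization at \<open>v\<close> and at \<open>u\<close>, the vector \<open>M v\<close> rescaled to the length of \<open>v\<close>: for
  vectors of equal length the parallelogram law makes the estimate lossless.\<close>
lemma onorm_symmetric_le:
  fixes M :: "real ^ 'p ^ 'p"
  assumes sym: "transpose M = M" and q: "\<And>v. \<bar>v \<bullet> (M *v v)\<bar> \<le> c * (v \<bullet> v)"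
  shows "onorm ((*v) M) \<le> c"
proof (rule onorm_le)
  fix v :: "real ^ 'p"
  show "norm (M *v v) \<le> c * norm v"
  proof (cases "M *v v = 0 \<or> v = 0")
    case True
    have "0 \<le> c * (v \<bullet> v)" using q[of v] by linarith
    then have "v = 0 \<or> 0 \<le> c" using inner_ge_zero[of v] inner_eq_zero_iff[of v]
      by (auto simp: zero_le_mult_iff simp del: inner_ge_zero)
    then show ?thesis using True by auto
  next
    case False
    define t where "t = norm v / norm (M *v v)"
    define u where "u = t *\<^sub>R (M *v v)"
    have uu: "u \<bullet> u = v \<bullet> v"
      using False by (simp add: u_def t_def dot_square_norm field_simps power2_eq_square)
    have s: "v \<bullet> (M *v u) = u \<bullet> (M *v v)"
      by (metis dot_lmul_matrix inner_commute sym transpose_matrix_vector)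
    have "4 * (u \<bullet> (M *v v)) = (u + v) \<bullet> (M *v (u + v)) - (u - v) \<bullet> (M *v (u - v))"
      using s by (simp add: inner_simps matrix_vector_right_distrib matrix_vector_mult_diff_distrib)
    also have "\<dots> \<le> c * ((u + v) \<bullet> (u + v)) + c * ((u - v) \<bullet> (u - v))"
      using q[of "u + v"] q[of "u - v"] by linarith
    also have "\<dots> = 4 * (c * (v \<bullet> v))"
      using uu by (simp add: inner_simps inner_commute algebra_simps)
    finally have "u \<bullet> (M *v v) \<le> c * (norm v * norm v)"
      by (simp add: dot_square_norm power2_eq_square)
    moreover have "u \<bullet> (M *v v) = norm v * norm (M *v v)"
      using False by (simp add: u_def t_def dot_square_norm power2_eq_square)
    ultimately show ?thesis
      using False by (simp add: algebra_simps)
  qed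
qed

text \<open>A spectral decomposition is avoided by log-convexity of the norms of iterates: two applications
  of Cauchy-Schwarz give \<open>|Sx|^2 \<le> |x| |S^2 x|\<close> and \<open>|S^2 x|^2 \<le> |Sx| |S^3 x|\<close>, hence
  \<open>|Sx|^3 \<le> |x|^2 |S^3 x|\<close>.\<close>
lemma psd_le_cube_norm:
  assumes S: "psd S" and c: "0 \<le> c" and cube: "\<And>x. norm (S (S (S x))) \<le> c ^ 3 * norm x"
  shows "x \<bullet> S x \<le> c * (x \<bullet> x)"
proof -
  have n2: "norm (S x) ^ 2 \<le> norm x * norm (S (S x))"
    using norm_cauchy_schwarz[of x "S (S x)"] psd_sym[OF S, of x "S x"]
    by (simp add: dot_square_norm)
  have "norm (S (S x)) ^ 2 = S x \<bullet> S (S (S x))"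
    using psd_sym[OF S, of "S x" "S (S x)"] by (simp add: dot_square_norm)
  also have "\<dots> \<le> norm (S x) * norm (S (S (S x)))"
    by (rule norm_cauchy_schwarz)
  also have "\<dots> \<le> norm (S x) * (c ^ 3 * norm x)"
    by (intro mult_left_mono cube) simp
  finally have n3: "norm (S (S x)) ^ 2 \<le> norm (S x) * (c ^ 3 * norm x)" .
  have "norm (S x) * norm (S x) ^ 3 = (norm (S x) ^ 2) ^ 2"
    by (simp add: power2_eq_square power3_eq_cube)
  also have "\<dots> \<le> (norm x * norm (S (S x))) ^ 2"
    by (intro power_mono n2) simp
  also have "\<dots> \<le> norm x ^ 2 * (norm (S x) * (c ^ 3 * norm x))"
    unfolding power_mult_distrib by (intro mult_left_mono n3) simp
  also have "\<dots> = norm (S x) * (c * norm x) ^ 3"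
    by (simp add: power2_eq_square power3_eq_cube)
  finally have "norm (S x) = 0 \<or> norm (S x) ^ 3 \<le> (c * norm x) ^ 3"
    using mult_le_cancel_left_pos[of "norm (S x)"] by (cases "norm (S x) = 0") simp_all
  then have "norm (S x) \<le> c * norm x"
    using c by (auto simp: power_mono_iff)
  then have "norm x * norm (S x) \<le> c * (x \<bullet> x)"
    using mult_left_mono[of "norm (S x)" "c * norm x" "norm x"]
    by (simp add: dot_square_norm power2_eq_square algebra_simps)
  then show ?thesis
    using norm_cauchy_schwarz[of x "S x"] by linarith
qed

lemma positive_definite_psd:
  assumes "positive_definite M"
  shows "psd ((*v) M)"
  unfolding psd_def
proof safe
  show "linear ((*v) M)" by simp
  show "(M *v x) \<bullet> y = x \<bullet> (M *v y)" for x y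
    using assms unfolding positive_definite_def
    by (metis dot_lmul_matrix transpose_matrix_vector)
  show "0 \<le> x \<bullet> (M *v x)" for x
    using assms unfolding positive_definite_def by (cases "x = 0") (auto intro: less_imp_le)
qed

section \<open>The inequality for positive definite matrices\<close>

lemma sum_matrix_vector_mult: "(\<Sum>j\<in>J. M j) *v x = (\<Sum>j\<in>J. M j *v x)"
  by (induction J rule: infinite_finite_induct) (auto simp: matrix_vector_mult_add_rdistrib)

lemma transpose_sum: "transpose (\<Sum>j\<in>J. M j) = (\<Sum>j\<in>J. transpose (M j))"
  by (simp add: vec_eq_iff transpose_def)

theorem mainTheorem1:
  fixes k n :: nat
    and A :: "nat \<Rightarrow> real ^ 'p ^ 'p"
  assumes "k > 0" and "n = 3 * k"
    and "\<And>j. j \<in> {1..n} \<Longrightarrow> positive_definite (A j)"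
  shows "1 / real n ^ 3 *
           onorm ((*v) (\<Sum>(j1, j2, j3)\<in>{1..n} \<times> {1..n} \<times> {1..n}. A j1 ** A j2 ** A j3))
         \<ge> fact (n - 3) / fact n *
           onorm ((*v) (\<Sum>(j1, j2, j3)\<in>{(j1, j2, j3). j1 \<in> {1..n} \<and> j2 \<in> {1..n} \<and> j3 \<in> {1..n}
                                           \<and> j1 \<noteq> j2 \<and> j1 \<noteq> j3 \<and> j2 \<noteq> j3}. A j1 ** A j2 ** A j3))"
proof -
  let ?T = "\<Sum>(j1, j2, j3)\<in>{1..n} \<times> {1..n} \<times> {1..n}. A j1 ** A j2 ** A j3"
  let ?D = "\<Sum>(a, b, c)\<in>distinct_triples {1..n}. A a ** A b ** A c"
  define S where "S = (\<lambda>x. \<Sum>j\<in>{1..n}. A j *v x)"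
  have psd_A: "psd ((*v) (A j))" if "j \<in> {1..n}" for j
    using positive_definite_psd assms(3) that .
  have S: "psd S"
    unfolding S_def by (rule psd_sum) (rule psd_A)
  have T: "?T *v x = S (S (S x))" for x
    unfolding S_def
    by (simp add: sum_matrix_vector_mult sum.cartesian_product' case_prod_unfold
        matrix_vector_mul_assoc[symmetric] linear_sum[OF matrix_vector_mul_linear])
  \<comment> \<open>The choice of \<open>d\<close> makes \<open>27 d^3\<close> the norm on the left-hand side of the theorem.\<close>
  define c where "c = root 3 (onorm ((*v) ?T))"
  define d where "d = c / 3"
  have c3: "c ^ 3 = onorm ((*v) ?T)" and c0: "0 \<le> c"
    unfolding c_def by (auto simp: odd_real_root_pow onorm_pos_le)
  have "norm (S (S (S x))) \<le> c ^ 3 * norm x" for x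
    unfolding c3 T[symmetric] by (rule onorm) simp
  from psd_le_cube_norm[OF S c0 this]
  have S_le: "(\<Sum>j\<in>{1..n}. x \<bullet> (A j *v x)) \<le> 3 * d * (x \<bullet> x)" for x
    by (simp add: S_def d_def inner_sum_right)
  have sym_A: "transpose (A j) = A j" if "j \<in> {1..n}" for j
    using assms(3)[OF that] by (simp add: positive_definite_def)
  have "transpose ?D = (\<Sum>(a, b, c)\<in>distinct_triples {1..n}. A c ** A b ** A a)"
    unfolding transpose_sum
    by (intro sum.cong refl)
      (auto simp: distinct_triples_def matrix_transpose_mul sym_A matrix_mul_assoc)
  also have "\<dots> = ?D"
    by (rule sum.reindex_bij_witness[where i = "\<lambda>(a, b, c). (c, b, a)" and j = "\<lambda>(a, b, c). (c, b, a)"])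
      (auto simp: distinct_triples_def)
  finally have sym: "transpose ?D = ?D" .
  have quad: "v \<bullet> (?D *v v)
      = (\<Sum>(a, b, c)\<in>distinct_triples {1..n}. (A a *v v) \<bullet> (A b *v (A c *v v)))" for v
    unfolding sum_matrix_vector_mult inner_sum_right
    by (intro sum.cong refl)
      (auto simp: distinct_triples_def matrix_vector_mul_assoc[symmetric] psd_sym[OF psd_A])
  define K where "K = real k ^ 3 * fact (n - 3)"
  have K: "0 < K" using \<open>k > 0\<close> by (simp add: K_def)
  have "onorm ((*v) ?D) \<le> fact n * d ^ 3 / K"
  proof (rule onorm_symmetric_le[OF sym])
    fix v :: "real ^ 'p"
    have "K * \<bar>v \<bullet> (?D *v v)\<bar> \<le> fact n * (d ^ 3 * (v \<bullet> v))"
      unfolding quad K_def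
      using distinct_triples_average_bound[of "{1..n}" k "\<lambda>j. (*v) (A j)" d v]
        assms(2) psd_A S_le c0 by (simp add: d_def)
    then show "\<bar>v \<bullet> (?D *v v)\<bar> \<le> fact n * d ^ 3 / K * (v \<bullet> v)"
      using K by (simp add: field_simps)
  qed
  then have "fact (n - 3) / fact n * onorm ((*v) ?D) \<le> fact (n - 3) / fact n * (fact n * d ^ 3 / K)"
    by (intro mult_left_mono) auto
  also have "\<dots> = 1 / real n ^ 3 * onorm ((*v) ?T)"
    using \<open>k > 0\<close> unfolding c3[symmetric] unfolding K_def d_def assms(2)
    by (simp add: field_simps)
  finally show ?thesis
    unfolding distinct_triples_def .
qed

end
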